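(* Let $a\in\mathbb{R}$ and $f:[a,\infty)\to\mathbb{R}$, and suppose there exists a number $\alpha\in(0,1]$ such that the conformable derivative $T^{\alpha}_a f(a)$ at the lower terminal $a$ exists. Then for every $\beta\in(0,\alpha)$ the conformable derivative $T^{\beta}_a f(a)$ also exists and $$T^{\beta}_a f(a)=0.$$
   Context: For $a\in\mathbb{R}$, $\alpha\in(0,1]$, a function $f:[a,\infty)\to\mathbb{R}$ and a point $t\in(a,\infty)$, the (left-sided) conformable derivative of order $\alpha$ of $f$ at $t$ with lower terminal $a$ is $$T^{\alpha}_a f(t)=\lim_{\theta\to 0}\frac{f\big(t+\theta(t-a)^{1-\alpha}\big)-f(t)}{\theta},$$ provided this (finite, two-sided) limit exists; $f$ is then called $\alpha$-differentiable at $t$. At the lower terminal $a$ itself, the conformable derivative is defined as follows: if $f$ is $\alpha$-differentiable at every point of some interval $(a,a+\varepsilon)$, $\varepsilon>0$, and the (finite) limit $\lim_{t\to a+}T^{\alpha}_a f(t)$ exists, then $T^{\alpha}_a f(a)$ exists and $T^{\alpha}_a f(a)=\lim_{t\to a+}T^{\alpha}_a f(t)$; otherwise $T^{\alpha}_a f(a)$ does not exist. *)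

theory Defs
  imports Complex_Main
begin

text \<open>
  Functions on the half-line from \<open>a\<close> to infinity are represented by total functions on the reals.
  The values below \<open>a\<close> are irrelevant: for \<open>t > a\<close> the limit in \<open>\<theta>\<close> depends only on the values
  of \<open>f\<close> in a small neighbourhood of \<open>t\<close>, and the derivative at \<open>a\<close> only on the
  derivatives at points to the right of \<open>a\<close>.  The order \<open>\<alpha>\<close> is meant to lie in \<open>{0<..1}\<close>.
\<close>

definition conf_quotient :: "real \<Rightarrow> real \<Rightarrow> (real \<Rightarrow> real) \<Rightarrow> real \<Rightarrow> real \<Rightarrow> real" where
  "conf_quotient \<alpha> a f t \<theta> = (f (t + \<theta> * (t - a) powr (1 - \<alpha>)) - f t) / \<theta>"

definition conf_differentiable_above :: "real \<Rightarrow> real \<Rightarrow> (real \<Rightarrow> real) \<Rightarrow> real \<Rightarrow> bool" where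
  "conf_differentiable_above \<alpha> a f t \<longleftrightarrow>
     a < t \<and> (\<exists>L. (conf_quotient \<alpha> a f t \<longlongrightarrow> L) (at 0))"

definition conf_deriv_above :: "real \<Rightarrow> real \<Rightarrow> (real \<Rightarrow> real) \<Rightarrow> real \<Rightarrow> real" where
  "conf_deriv_above \<alpha> a f t = Lim (at 0) (conf_quotient \<alpha> a f t)"

text \<open>
  The derivative on all of the half-line, including the lower terminal.
  The value \<open>conf_deriv \<alpha> a f t\<close> is meaningful only when \<open>conf_differentiable \<alpha> a f t\<close> holds.
\<close>

definition conf_differentiable :: "real \<Rightarrow> real \<Rightarrow> (real \<Rightarrow> real) \<Rightarrow> real \<Rightarrow> bool" where
  "conf_differentiable \<alpha> a f t \<longleftrightarrow>
     (if t = a then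
        (\<exists>\<epsilon>>0. \<forall>s\<in>{a<..<a + \<epsilon>}. conf_differentiable_above \<alpha> a f s) \<and>
        (\<exists>L. (conf_deriv_above \<alpha> a f \<longlongrightarrow> L) (at_right a))
      else conf_differentiable_above \<alpha> a f t)"

definition conf_deriv :: "real \<Rightarrow> real \<Rightarrow> (real \<Rightarrow> real) \<Rightarrow> real \<Rightarrow> real" where
  "conf_deriv \<alpha> a f t =
     (if t = a then Lim (at_right a) (conf_deriv_above \<alpha> a f) else conf_deriv_above \<alpha> a f t)"

end

theory Submission
  imports Defs
begin

text \<open>
  Changing the order from \<open>\<alpha>\<close> to \<open>\<beta>\<close> only rescales the increment: since
  \<open>(t - a) powr (1 - \<beta>) = c * (t - a) powr (1 - \<alpha>)\<close> with \<open>c = (t - a) powr (\<alpha> - \<beta>)\<close>,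
  the quotient of order \<open>\<beta>\<close> at \<open>\<theta>\<close> is \<open>c\<close> times the quotient of order \<open>\<alpha>\<close> at \<open>c * \<theta>\<close>
  (\<open>conf_quotient_change_order\<close>). Hence above the terminal both derivatives exist together and
  differ by the factor \<open>c\<close> (\<open>conf_deriv_above_change_order\<close>). As \<open>t\<close> decreases to \<open>a\<close>,
  the derivative of order \<open>\<alpha>\<close> has a finite limit, while \<open>c\<close> tends to \<open>0\<close> when \<open>\<beta> < \<alpha>\<close>;
  so the derivative of order \<open>\<beta>\<close> tends to \<open>0\<close>.
\<close>

lemma conf_quotient_change_order:
  assumes "a < t"
  shows "conf_quotient \<beta> a f t \<theta> =
    (t - a) powr (\<alpha> - \<beta>) * conf_quotient \<alpha> a f t ((t - a) powr (\<alpha> - \<beta>) * \<theta>)"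
proof -
  have "(t - a) powr (1 - \<beta>) = (t - a) powr (\<alpha> - \<beta>) * (t - a) powr (1 - \<alpha>)"
    by (simp flip: powr_add)
  then show ?thesis
    using assms by (simp add: conf_quotient_def mult_ac)
qed

lemma conf_quotient_tendsto_change_order:
  assumes "a < t" and lim: "(conf_quotient \<alpha> a f t \<longlongrightarrow> L) (at 0)"
  shows "(conf_quotient \<beta> a f t \<longlongrightarrow> (t - a) powr (\<alpha> - \<beta>) * L) (at 0)"
proof -
  define c where "c = (t - a) powr (\<alpha> - \<beta>)"
  have "c \<noteq> 0"
    using assms(1) by (simp add: c_def)
  have "((\<lambda>\<theta>. c * \<theta>) \<longlongrightarrow> c * 0) (at 0)"
    by (intro tendsto_intros)
  then have "filterlim (\<lambda>\<theta>. c * \<theta>) (at 0) (at 0)"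
    using \<open>c \<noteq> 0\<close> by (auto simp: filterlim_at eventually_at_filter)
  then have "((\<lambda>\<theta>. conf_quotient \<alpha> a f t (c * \<theta>)) \<longlongrightarrow> L) (at 0)"
    by (rule filterlim_compose[OF lim])
  then have "((\<lambda>\<theta>. c * conf_quotient \<alpha> a f t (c * \<theta>)) \<longlongrightarrow> c * L) (at 0)"
    by (rule tendsto_mult_left)
  moreover have "conf_quotient \<beta> a f t = (\<lambda>\<theta>. c * conf_quotient \<alpha> a f t (c * \<theta>))"
    using conf_quotient_change_order[OF assms(1)] by (auto simp: c_def)
  ultimately show ?thesis
    by (simp add: c_def)
qed

lemma conf_differentiable_above_change_order:
  assumes "conf_differentiable_above \<alpha> a f t"
  shows "conf_differentiable_above \<beta> a f t"
  using assms conf_quotient_tendsto_change_order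
  unfolding conf_differentiable_above_def by blast

lemma conf_deriv_above_change_order:
  assumes "conf_differentiable_above \<alpha> a f t"
  shows "conf_deriv_above \<beta> a f t = (t - a) powr (\<alpha> - \<beta>) * conf_deriv_above \<alpha> a f t"
proof -
  obtain L where "a < t" and L: "(conf_quotient \<alpha> a f t \<longlongrightarrow> L) (at 0)"
    using assms unfolding conf_differentiable_above_def by blast
  have "conf_deriv_above \<alpha> a f t = L"
    unfolding conf_deriv_above_def by (rule tendsto_Lim[OF _ L]) simp
  moreover have "conf_deriv_above \<beta> a f t = (t - a) powr (\<alpha> - \<beta>) * L"
    unfolding conf_deriv_above_def
    by (rule tendsto_Lim[OF _ conf_quotient_tendsto_change_order[OF \<open>a < t\<close> L]]) simp
  ultimately show ?thesis
    by simp
qed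

lemma powr_diff_tendsto_0_at_right:
  fixes a p :: real
  assumes "0 < p"
  shows "((\<lambda>t. (t - a) powr p) \<longlongrightarrow> 0) (at_right a)"
proof -
  have "((\<lambda>t. t - a) \<longlongrightarrow> a - a) (at_right a)"
    by (intro tendsto_intros)
  moreover have "\<forall>\<^sub>F t in at_right a. 0 \<le> t - a"
    by (simp add: eventually_at_filter)
  ultimately show ?thesis
    using assms tendsto_powr'[of "\<lambda>t. t - a" 0 "at_right a" "\<lambda>_. p" p] by simp
qed

theorem theorem3p10:
  fixes a \<alpha> :: real and f :: "real \<Rightarrow> real"
  assumes "0 < \<alpha>" and "\<alpha> \<le> 1"
    and "conf_differentiable \<alpha> a f a"
  shows "\<forall>\<beta>. 0 < \<beta> \<and> \<beta> < \<alpha> \<longrightarrow> conf_differentiable \<beta> a f a \<and> conf_deriv \<beta> a f a = 0"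
proof (intro allI impI)
  fix \<beta> assume \<beta>: "0 < \<beta> \<and> \<beta> < \<alpha>"
  obtain \<epsilon> L where "0 < \<epsilon>"
    and diff: "\<forall>s\<in>{a<..<a + \<epsilon>}. conf_differentiable_above \<alpha> a f s"
    and L: "(conf_deriv_above \<alpha> a f \<longlongrightarrow> L) (at_right a)"
    using assms(3) unfolding conf_differentiable_def by auto
  have near: "\<forall>\<^sub>F t in at_right a. t \<in> {a<..<a + \<epsilon>}"
    using \<open>0 < \<epsilon>\<close> by (intro eventually_at_right_real) simp
  have "((\<lambda>t. (t - a) powr (\<alpha> - \<beta>) * conf_deriv_above \<alpha> a f t) \<longlongrightarrow> 0 * L) (at_right a)"
    using \<beta> by (intro tendsto_mult powr_diff_tendsto_0_at_right L) simp
  moreover have "\<forall>\<^sub>F t in at_right a.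
      (t - a) powr (\<alpha> - \<beta>) * conf_deriv_above \<alpha> a f t = conf_deriv_above \<beta> a f t"
    using near by eventually_elim (use diff conf_deriv_above_change_order in metis)
  ultimately have lim: "(conf_deriv_above \<beta> a f \<longlongrightarrow> 0) (at_right a)"
    by (simp add: tendsto_cong)
  have "\<forall>s\<in>{a<..<a + \<epsilon>}. conf_differentiable_above \<beta> a f s"
    using diff conf_differentiable_above_change_order by blast
  then have "conf_differentiable \<beta> a f a"
    using \<open>0 < \<epsilon>\<close> lim unfolding conf_differentiable_def by auto
  moreover have "conf_deriv \<beta> a f a = 0"
    using tendsto_Lim[OF _ lim] by (simp add: conf_deriv_def)
  ultimately show "conf_differentiable \<beta> a f a \<and> conf_deriv \<beta> a f a = 0" ..
qed

end
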